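(* Let $X=\{X_1,\dots,X_n\}$ be $n$ samples drawn independently from $q$, and let $\hat{w}_X(\theta)$ be any posterior, i.e. a measurable nonnegative function on $\mathcal{X}^n\times\Gamma$ such that for every $X$ the function $\hat{w}_X(\cdot)$ is a probability density on $\Gamma$ with respect to $\pi$. Consider a measurable function $\ell_\theta(x):\Gamma\times\mathcal{X}\to\mathbb{R}$ and real numbers $\alpha$ and $\beta$, and define $$c_n(\alpha,\beta)=\frac1n\ln \mathbf{E}_\pi\left(\frac{\mathbf{E}_q e^{-\ell_\theta(x)}}{\big(\mathbf{E}_q e^{-\beta\ell_\theta(x)}\big)^{\alpha}}\right)^n .$$ Then for all $t$, the following event holds with probability at least $1-\exp(-t)$ (over $X$): $$-\alpha\,\mathbf{E}_\pi\hat{w}_X(\theta)\ln \mathbf{E}_q e^{-\beta\ell_\theta(x)}\le \frac{\mathbf{E}_\pi\hat{w}_X(\theta)\sum_{i=1}^n\ell_\theta(X_i)+D_{\mathrm{KL}}(\hat{w}_X\,d\pi\|d\pi)+t}{n}+c_n(\alpha,\beta).$$ Moreover, $$-\alpha\,\mathbf{E}_X\mathbf{E}_\pi\hat{w}_X(\theta)\ln \mathbf{E}_q e^{-\beta\ell_\theta(x)}\le \mathbf{E}_X\frac{\mathbf{E}_\pi\hat{w}_X(\theta)\sum_{i=1}^n\ell_\theta(X_i)+D_{\mathrm{KL}}(\hat{w}_X\,d\pi\|d\pi)}{n}+c_n(\alpha,\beta).$$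
   Context: $\mathcal{X}$ is a sample space with a measure $\mu$; $q$ is a probability density with respect to $\mu$ (the true density). $\mathbf{E}_q$ denotes expectation over a single $x\sim q$, and $\mathbf{E}_X$ expectation over the $n$ i.i.d. samples $X$. $\Gamma$ is a parameter space with a probability measure $\pi$ (the prior) that does not depend on $X$; $\mathbf{E}_\pi f(\theta)=\int_\Gamma f(\theta)\,d\pi(\theta)$. For a density $w$ on $\Gamma$ with respect to $\pi$, $D_{\mathrm{KL}}(w\,d\pi\|d\pi)=\int_\Gamma w(\theta)\ln w(\theta)\,d\pi(\theta)\in[0,+\infty]$. All quantities are assumed measurable, and the expressions appearing are assumed to be well defined. *)

theory Defs
  imports "HOL-Probability.Probability"
begin

section \<open>Extended-real logarithm, powers and integrals\<close>

definition eln :: "ennreal \<Rightarrow> ereal" where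
  "eln x = (if x = 0 then -\<infinity> else if x = \<top> then \<infinity> else ereal (ln (enn2real x)))"

text \<open>Unlike \<open>0 powr a = 0\<close> on the reals, a zero or infinite base follows the limit
  convention, with exponent \<open>0\<close> giving \<open>1\<close>.\<close>

definition epowr :: "ennreal \<Rightarrow> real \<Rightarrow> ennreal" where
  "epowr x a =
    (if a = 0 then 1
     else if x = 0 then (if a > 0 then 0 else \<top>)
     else if x = \<top> then (if a > 0 then \<top> else 0)
     else ennreal (enn2real x powr a))"

text \<open>The integral of an extended-real function with values in \<open>[-\<infinity>, \<infinity>]\<close>. The Bochner integral
  is real-valued and returns \<open>0\<close> on non-integrable functions, so it cannot be used for
  quantities that may be infinite. Here \<^const>\<open>e2ennreal\<close> takes the positive part. The value is
  meaningful only if one of the two parts is finite.\<close>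

definition ext_integral :: "'a measure \<Rightarrow> ('a \<Rightarrow> ereal) \<Rightarrow> ereal" where
  "ext_integral M f =
    enn2ereal (\<integral>\<^sup>+ x. e2ennreal (f x) \<partial>M) - enn2ereal (\<integral>\<^sup>+ x. e2ennreal (- f x) \<partial>M)"

definition quasi_integrable :: "'a measure \<Rightarrow> ('a \<Rightarrow> ereal) \<Rightarrow> bool" where
  "quasi_integrable M f \<longleftrightarrow>
    (\<integral>\<^sup>+ x. e2ennreal (f x) \<partial>M) < \<top> \<or> (\<integral>\<^sup>+ x. e2ennreal (- f x) \<partial>M) < \<top>"

text \<open>On \<^typ>\<open>ereal\<close> the sum \<open>\<infinity> + (-\<infinity>)\<close> has a default value; this excludes it.\<close>

definition add_defined :: "ereal \<Rightarrow> ereal \<Rightarrow> bool" where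
  "add_defined a b \<longleftrightarrow> \<not> (a = \<infinity> \<and> b = -\<infinity>) \<and> \<not> (a = -\<infinity> \<and> b = \<infinity>)"

lemma e2ennreal_ereal: "e2ennreal (ereal r) = ennreal r"
  by (simp add: e2ennreal_def ennreal.abs_eq ennreal_def zero_ereal_def max_def)

lemma ext_integral_integrable:
  assumes "integrable M f"
  shows "quasi_integrable M (\<lambda>x. ereal (f x))"
    and "ext_integral M (\<lambda>x. ereal (f x)) = ereal (\<integral>x. f x \<partial>M)"
proof -
  have p: "(\<integral>\<^sup>+ x. ennreal (f x) \<partial>M) \<noteq> \<infinity>" and m: "(\<integral>\<^sup>+ x. ennreal (- f x) \<partial>M) \<noteq> \<infinity>"
    using assms by (auto simp: real_integrable_def)
  show "quasi_integrable M (\<lambda>x. ereal (f x))"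
    using p by (simp add: quasi_integrable_def e2ennreal_ereal less_top)
  show "ext_integral M (\<lambda>x. ereal (f x)) = ereal (\<integral>x. f x \<partial>M)"
    using p m
    by (cases "\<integral>\<^sup>+ x. ennreal (f x) \<partial>M"; cases "\<integral>\<^sup>+ x. ennreal (- f x) \<partial>M")
       (auto simp: ext_integral_def e2ennreal_ereal real_lebesgue_integral_def[OF assms] enn2ereal_ennreal)
qed

section \<open>Samples, posteriors and risks\<close>

definition is_density :: "'a measure \<Rightarrow> ('a \<Rightarrow> real) \<Rightarrow> bool" where
  "is_density M f \<longleftrightarrow>
    f \<in> borel_measurable M \<and> (\<forall>x\<in>space M. 0 \<le> f x) \<and> (\<integral>\<^sup>+ x. ennreal (f x) \<partial>M) = 1"

text \<open>The joint law of \<open>X\<^sub>1, \<dots>, X\<^sub>n\<close>, drawn independently from the density \<open>q\<close>;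
  a sample is a function on \<open>{1..n}\<close>.\<close>

definition sample_law :: "'x measure \<Rightarrow> ('x \<Rightarrow> real) \<Rightarrow> nat \<Rightarrow> (nat \<Rightarrow> 'x) measure" where
  "sample_law \<mu> q n = (\<Pi>\<^sub>M i\<in>{1..n}. density \<mu> (\<lambda>x. ennreal (q x)))"

definition is_posterior ::
  "'x measure \<Rightarrow> ('x \<Rightarrow> real) \<Rightarrow> nat \<Rightarrow> 't measure \<Rightarrow> ((nat \<Rightarrow> 'x) \<Rightarrow> 't \<Rightarrow> real) \<Rightarrow> bool" where
  "is_posterior \<mu> q n \<pi> w \<longleftrightarrow>
    (\<lambda>(X, \<theta>). w X \<theta>) \<in> borel_measurable (sample_law \<mu> q n \<Otimes>\<^sub>M \<pi>) \<and>
    (\<forall>X\<in>space (sample_law \<mu> q n). is_density \<pi> (w X))"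

text \<open>\<open>E\<^sub>q exp (- b * \<ell>\<^sub>\<theta>(x))\<close>\<close>

definition exp_moment ::
  "'x measure \<Rightarrow> ('x \<Rightarrow> real) \<Rightarrow> ('t \<Rightarrow> 'x \<Rightarrow> real) \<Rightarrow> real \<Rightarrow> 't \<Rightarrow> ennreal" where
  "exp_moment \<mu> q l b \<theta> = (\<integral>\<^sup>+ x. ennreal (exp (- b * l \<theta> x)) \<partial>density \<mu> (\<lambda>x. ennreal (q x)))"

definition c_n ::
  "'x measure \<Rightarrow> ('x \<Rightarrow> real) \<Rightarrow> 't measure \<Rightarrow> ('t \<Rightarrow> 'x \<Rightarrow> real) \<Rightarrow> nat \<Rightarrow> real \<Rightarrow> real \<Rightarrow> ereal" where
  "c_n \<mu> q \<pi> l n \<alpha> \<beta> =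
    ereal (1 / real n) *
    eln (\<integral>\<^sup>+ \<theta>. (exp_moment \<mu> q l 1 \<theta> / epowr (exp_moment \<mu> q l \<beta> \<theta>) \<alpha>) ^ n \<partial>\<pi>)"

text \<open>\<open>D\<^sub>K\<^sub>L(v d\<pi> || d\<pi>)\<close> for a density \<open>v\<close> with respect to \<open>\<pi>\<close>, with value \<open>\<infinity>\<close> allowed
  (the library's \<^const>\<open>KL_divergence\<close> is real-valued).\<close>

definition D_KL :: "'t measure \<Rightarrow> ('t \<Rightarrow> real) \<Rightarrow> ereal" where
  "D_KL \<pi> v = ext_integral \<pi> (\<lambda>\<theta>. ereal (v \<theta> * ln (v \<theta>)))"

text \<open>The integrands of \<open>E\<^sub>\<pi> v(\<theta>) \<Sum>\<^sub>i \<ell>\<^sub>\<theta>(X\<^sub>i)\<close> and of \<open>E\<^sub>\<pi> v(\<theta>) ln E\<^sub>q exp (- \<beta> * \<ell>\<^sub>\<theta>(x))\<close>\<close>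

definition emp_integrand ::
  "('t \<Rightarrow> 'x \<Rightarrow> real) \<Rightarrow> nat \<Rightarrow> (nat \<Rightarrow> 'x) \<Rightarrow> ('t \<Rightarrow> real) \<Rightarrow> 't \<Rightarrow> ereal" where
  "emp_integrand l n X v \<theta> = ereal (v \<theta> * (\<Sum>i=1..n. l \<theta> (X i)))"

definition log_integrand ::
  "'x measure \<Rightarrow> ('x \<Rightarrow> real) \<Rightarrow> ('t \<Rightarrow> 'x \<Rightarrow> real) \<Rightarrow> real \<Rightarrow> ('t \<Rightarrow> real) \<Rightarrow> 't \<Rightarrow> ereal" where
  "log_integrand \<mu> q l \<beta> v \<theta> = ereal (v \<theta>) * eln (exp_moment \<mu> q l \<beta> \<theta>)"

end

theory Submission
  imports Defs
begin

text \<open>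
  Both inequalities come from one duality between relative entropy and exponential moments. Let
  \<open>M\<^sub>b(\<theta>)\<close> denote \<open>E\<^sub>q exp (- b * \<ell>\<^sub>\<theta>(x))\<close>, and put \<open>u(\<theta>) = M\<^sub>\<beta>(\<theta>)\<^sup>-\<^sup>\<alpha>\<^sup>n\<close> and
  \<open>G(X) = E\<^sub>\<pi> exp (- \<Sum>\<^sub>i \<ell>\<^sub>\<theta>(X\<^sub>i)) u(\<theta>)\<close>. For a fixed sample \<open>X\<close>, the Donsker--Varadhan inequality
  (\<open>donsker_varadhan\<close>) gives
  \<open>- \<alpha> n E\<^sub>\<pi> w\<^sub>X ln M\<^sub>\<beta> \<le> E\<^sub>\<pi> w\<^sub>X \<Sum>\<^sub>i \<ell>\<^sub>\<theta>(X\<^sub>i) + D\<^sub>K\<^sub>L(w\<^sub>X d\<pi> || d\<pi>) + ln G(X)\<close>.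
  The last term does not depend on the posterior. By Tonelli and independence,
  \<open>E\<^sub>X G(X) = E\<^sub>\<pi> M\<^sub>1\<^sup>n u = exp (n c\<^sub>n)\<close> (\<open>expected_gibbs_mass\<close>), because the prior does not see the
  sample. Markov's inequality now bounds \<open>ln G(X)\<close> by \<open>t + n c\<^sub>n\<close> outside an event of probability
  at most \<open>exp (- t)\<close> (\<open>eln_le_shifted_mean_prob\<close>), and concavity of the logarithm bounds its
  expectation by \<open>n c\<^sub>n\<close> (\<open>ext_integral_le_add_eln_mean\<close>).

  Every quantity may be infinite, so neither \<open>ln\<close> of a mean nor a difference of integrals can be
  handled freely. The proofs therefore use the concavity of \<open>ln\<close> only through its tangents,
  \<open>ln x \<le> c + exp (- c) x - 1\<close> for all real \<open>c\<close>: these are affine in \<open>x\<close>, so they can be integrated,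
  and their infimum over \<open>c\<close> is \<open>ln x\<close>, including \<open>- \<infinity>\<close> at \<open>x = 0\<close>. Integration of such a bound
  between extended-real functions is justified by \<open>ext_integral_mono_add\<close>.
\<close>

section \<open>The extended logarithm and power\<close>

lemma eln_measurable [measurable]: "eln \<in> borel_measurable borel"
  unfolding eln_def by measurable

lemma epowr_measurable [measurable]: "(\<lambda>x. epowr x a) \<in> borel_measurable borel"
  unfolding epowr_def by measurable

lemma eln_epowr: "eln (epowr x a) = ereal a * eln x"
  by (cases x) (auto simp: eln_def epowr_def ln_powr top_unique powr_gt_zero ennreal_eq_0_iff)

lemma eln_inverse: "eln (inverse x) = - eln x"
  by (cases x) (auto simp: eln_def inverse_ennreal ln_inverse ennreal_eq_0_iff)

lemma eln_power: "eln (x ^ n) = ereal (real n) * eln x"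
proof (cases x)
  case (real r)
  then show ?thesis
    by (cases "r = 0"; cases "n = 0")
       (auto simp: eln_def ennreal_power ln_realpow ennreal_eq_0_iff power_0_left not_le zero_less_power)
next
  case top
  then show ?thesis by (cases "n = 0") (auto simp: eln_def power_eq_top_ennreal)
qed

lemma eln_le_tangent:
  assumes "x < \<top>"
  shows "eln x \<le> ereal (c + exp (- c) * enn2real x - 1)"
proof (cases "x = 0")
  case False
  then have pos: "0 < enn2real x" using assms by (simp add: enn2real_positive_iff zero_less_iff_neq_zero)
  then have "ln (exp (- c) * enn2real x) \<le> exp (- c) * enn2real x - 1"
    by (intro ln_le_minus_one) simp
  then show ?thesis using False assms pos by (simp add: eln_def ln_mult)
qed (simp add: eln_def)

text \<open>The value \<open>ln x\<close> is attained by the tangent at \<open>c = ln x\<close> when \<open>x > 0\<close>; for \<open>x = 0\<close> the bounds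
  tend to \<open>- \<infinity>\<close> as \<open>c\<close> does. The convention \<open>\<infinity> + (- \<infinity>) = \<infinity>\<close> makes the case \<open>b = \<infinity>\<close> hold.\<close>

lemma le_add_eln_if_le_tangents:
  assumes "x < \<top>" and le: "\<And>c. a \<le> b + ereal (c + exp (- c) * enn2real x - 1)"
  shows "a \<le> b + eln x"
proof (cases "x = 0")
  case True
  have le': "a \<le> b + ereal c" for c
    using le[of "c + 1"] True by simp
  show ?thesis
  proof (cases b)
    case (real r)
    have "a \<le> ereal c" for c using le'[of "c - r"] real by simp
    then have "a = - \<infinity>" by (rule ereal_bot)
    then show ?thesis by simp
  qed (use le'[of 0] True in \<open>auto simp: eln_def\<close>)
next
  case False
  then have pos: "0 < enn2real x" using assms by (simp add: enn2real_positive_iff zero_less_iff_neq_zero)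
  show ?thesis
    using le[of "ln (enn2real x)"] False assms(1) pos by (simp add: eln_def exp_minus)
qed

section \<open>Linearity and monotonicity of the extended integral\<close>

lemma ext_integral_measurable:
  assumes "sigma_finite_measure N" and [measurable]: "(\<lambda>(x, y). f x y) \<in> borel_measurable (M \<Otimes>\<^sub>M N)"
  shows "(\<lambda>x. ext_integral N (f x)) \<in> borel_measurable M"
proof -
  interpret sigma_finite_measure N by fact
  show ?thesis
    unfolding ext_integral_def by measurable
qed

lemma ext_integral_uminus:
  assumes "quasi_integrable M f"
  shows "ext_integral M (\<lambda>x. - f x) = - ext_integral M f"
  using assms unfolding ext_integral_def quasi_integrable_def
  by (cases "\<integral>\<^sup>+ x. e2ennreal (f x) \<partial>M"; cases "\<integral>\<^sup>+ x. e2ennreal (- f x) \<partial>M")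
     (auto simp: enn2ereal_ennreal)

lemma e2ennreal_cmult:
  assumes "0 \<le> r" shows "e2ennreal (ereal r * x) = ennreal r * e2ennreal x"
  using assms
  by (cases x; cases "r = 0")
     (auto simp: e2ennreal_ereal ennreal_mult' ennreal_mult_top e2ennreal_neg e2ennreal_infty)

lemma ereal_mult_eq_minus_mult_minus: "ereal r * y = ereal (- r) * - y"
  by (cases y) auto

lemma quasi_integrable_cmult:
  assumes "f \<in> borel_measurable M" and "quasi_integrable M f"
  shows "quasi_integrable M (\<lambda>x. ereal r * f x)"
proof -
  have nonneg: "quasi_integrable M (\<lambda>x. ereal a * g x)"
    if [measurable]: "g \<in> borel_measurable M" and "quasi_integrable M g" "0 \<le> a" for g and a :: real
    using that unfolding quasi_integrable_def ereal_mult_minus_right[symmetric]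
    by (auto simp: e2ennreal_cmult nn_integral_cmult ennreal_mult_less_top simp del: ereal_mult_minus_right)
  show ?thesis
  proof (cases "0 \<le> r")
    case False
    have "quasi_integrable M (\<lambda>x. - f x)"
      using assms by (auto simp: quasi_integrable_def)
    then show ?thesis
      unfolding ereal_mult_eq_minus_mult_minus[of r] using False assms by (intro nonneg) auto
  qed (simp add: nonneg assms)
qed

lemma ext_integral_cmult_nonneg:
  assumes [measurable]: "f \<in> borel_measurable M" and "0 \<le> r"
  shows "ext_integral M (\<lambda>x. ereal r * f x) = ereal r * ext_integral M f"
proof -
  have "ext_integral M (\<lambda>x. ereal r * f x) =
     enn2ereal (ennreal r * (\<integral>\<^sup>+ x. e2ennreal (f x) \<partial>M)) - enn2ereal (ennreal r * (\<integral>\<^sup>+ x. e2ennreal (- f x) \<partial>M))"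
    using assms unfolding ext_integral_def ereal_mult_minus_right[symmetric]
    by (simp add: e2ennreal_cmult nn_integral_cmult del: ereal_mult_minus_right)
  also have "\<dots> = ereal r * ext_integral M f"
    using assms unfolding ext_integral_def
    by (cases "\<integral>\<^sup>+ x. e2ennreal (f x) \<partial>M"; cases "\<integral>\<^sup>+ x. e2ennreal (- f x) \<partial>M"; cases "r = 0")
       (auto simp: ennreal_mult_top right_diff_distrib enn2ereal_ennreal simp flip: ennreal_mult)
  finally show ?thesis .
qed

lemma ext_integral_cmult:
  assumes f [measurable]: "f \<in> borel_measurable M" and qi: "quasi_integrable M f"
  shows "ext_integral M (\<lambda>x. ereal r * f x) = ereal r * ext_integral M f"
proof (cases "0 \<le> r")
  case True
  then show ?thesis by (rule ext_integral_cmult_nonneg[OF f])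
next
  case False
  have "ext_integral M (\<lambda>x. ereal r * f x) = ereal (- r) * ext_integral M (\<lambda>x. - f x)"
    unfolding ereal_mult_eq_minus_mult_minus[of r]
    using False by (intro ext_integral_cmult_nonneg) auto
  then show ?thesis
    by (simp only: ext_integral_uminus[OF qi] ereal_mult_eq_minus_mult_minus[of r])
qed

text \<open>Moving every negative part to the other side turns the pointwise bound into an inequality
  between sums of nonnegative terms, which integrates without any finiteness. If all terms on the
  larger side have finite integral, then so do those on the smaller side and the parts can be moved
  back. Otherwise \<open>A\<close> has integral \<open>- \<infinity>\<close> by quasi-integrability, or one summand on the right has
  integral \<open>\<infinity>\<close>. The convention \<open>\<infinity> - \<infinity> = \<infinity>\<close> makes the bound hold
  for arbitrary \<open>B\<close> and \<open>C\<close>.\<close>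

lemma ext_integral_mono_add:
  assumes [measurable]: "A \<in> borel_measurable M" "B \<in> borel_measurable M" "C \<in> borel_measurable M"
    and h: "integrable M h"
    and qi: "quasi_integrable M A"
    and le: "AE x in M. A x \<le> B x + C x + ereal (h x)"
  shows "ext_integral M A \<le> ext_integral M B + ext_integral M C + ereal (\<integral>x. h x \<partial>M)"
proof -
  have [measurable]: "h \<in> borel_measurable M" using h by simp
  define pos neg where "pos f = (\<integral>\<^sup>+ x. e2ennreal (f x) \<partial>M)" and "neg f = (\<integral>\<^sup>+ x. e2ennreal (- f x) \<partial>M)"
    for f :: "'a \<Rightarrow> ereal"
  let ?h = "\<lambda>x. ereal (h x)"
  have cancel: "e2ennreal a + e2ennreal (- b) + e2ennreal (- c) + e2ennreal (- ereal r)
      \<le> e2ennreal (- a) + e2ennreal b + e2ennreal c + e2ennreal (ereal r)"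
    if "a \<le> b + c + ereal r" for a b c r
  proof -
    have *: "ennreal x + ennreal (- y) + ennreal (- z) + ennreal (- r)
        \<le> ennreal (- x) + ennreal y + ennreal z + ennreal r" if "x \<le> y + z + r" for x y z
    proof -
      have "ennreal (max 0 x + max 0 (- y) + max 0 (- z) + max 0 (- r))
        \<le> ennreal (max 0 (- x) + max 0 y + max 0 z + max 0 r)"
        using that by (intro ennreal_leI) auto
      then show ?thesis
        by (simp add: ennreal_plus flip: max.commute[of _ "0::real"]) 
    qed
    show ?thesis using that
      by (cases a; cases b; cases c) (auto simp: e2ennreal_ereal e2ennreal_neg intro: *)
  qed
  have "pos A + neg B + neg C + neg ?h \<le> neg A + pos B + pos C + pos ?h"
  proof -
    have "(\<integral>\<^sup>+ x. e2ennreal (A x) + e2ennreal (- B x) + e2ennreal (- C x) + e2ennreal (- ?h x) \<partial>M)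
      \<le> (\<integral>\<^sup>+ x. e2ennreal (- A x) + e2ennreal (B x) + e2ennreal (C x) + e2ennreal (?h x) \<partial>M)"
      by (intro nn_integral_mono_AE eventually_mono[OF le] cancel)
    then show ?thesis by (simp add: nn_integral_add pos_def neg_def)
  qed
  moreover have "ext_integral M f = enn2ereal (pos f) - enn2ereal (neg f)" for f
    by (simp add: ext_integral_def pos_def neg_def)
  moreover have "pos ?h < \<top>" "neg ?h < \<top>"
    using h by (auto simp: pos_def neg_def real_integrable_def e2ennreal_ereal less_top)
  moreover have "pos A < \<top> \<or> neg A < \<top>"
    using qi by (simp add: quasi_integrable_def pos_def neg_def)
  moreover have "ereal (\<integral>x. h x \<partial>M) = ext_integral M ?h"
    using ext_integral_integrable[OF h] by simp
  ultimately show ?thesis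
    by (cases "pos A"; cases "neg A"; cases "pos B"; cases "neg B"; cases "pos C"; cases "neg C";
        cases "pos ?h"; cases "neg ?h")
       (simp_all add: enn2ereal_ennreal top_unique flip: ennreal_plus)
qed


section \<open>The Donsker--Varadhan inequality\<close>

text \<open>For \<open>v > 0\<close> the tangent bound at \<open>c + s + ln v\<close> reads
  \<open>v ln u \<le> v s + v ln v + c v + exp (- c) exp (- s) u - v\<close>, and where \<open>v = 0\<close> it reads
  \<open>0 \<le> exp (- c) exp (- s) u\<close>. Integrating against \<open>\<pi>\<close> leaves the tangent of \<open>ln\<close> with parameter \<open>c\<close> at
  \<open>\<integral> exp (- s) u d\<pi>\<close>, and \<open>c\<close> is free. Working with \<open>u\<close> instead of its logarithm allows
  \<open>ln u\<close> to be infinite.\<close>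

lemma donsker_varadhan:
  fixes v s :: "'a \<Rightarrow> real"
  assumes "prob_space \<pi>" and v: "is_density \<pi> v"
    and [measurable]: "s \<in> borel_measurable \<pi>" "u \<in> borel_measurable \<pi>"
    and qi: "quasi_integrable \<pi> (\<lambda>\<theta>. ereal (v \<theta>) * eln (u \<theta>))"
  shows "ext_integral \<pi> (\<lambda>\<theta>. ereal (v \<theta>) * eln (u \<theta>))
    \<le> ext_integral \<pi> (\<lambda>\<theta>. ereal (v \<theta> * s \<theta>)) + D_KL \<pi> v
      + eln (\<integral>\<^sup>+ \<theta>. ennreal (exp (- s \<theta>)) * u \<theta> \<partial>\<pi>)"
proof (cases "(\<integral>\<^sup>+ \<theta>. ennreal (exp (- s \<theta>)) * u \<theta> \<partial>\<pi>) = \<top>")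
  case True
  then show ?thesis by (simp add: eln_def)
next
  case False
  define g where "g \<theta> = ennreal (exp (- s \<theta>)) * u \<theta>" for \<theta>
  have [measurable]: "g \<in> borel_measurable \<pi>" "v \<in> borel_measurable \<pi>"
    using v unfolding g_def by (auto simp: is_density_def)
  have g_finite: "AE \<theta> in \<pi>. g \<theta> \<noteq> \<infinity>"
    using False by (intro nn_integral_PInf_AE) (auto simp: g_def)
  have v_nonneg: "AE \<theta> in \<pi>. 0 \<le> v \<theta>" and v_mass: "(\<integral>\<^sup>+ \<theta>. ennreal (v \<theta>) \<partial>\<pi>) = 1"
    using v by (auto simp: is_density_def)
  have v_int: "integrable \<pi> v" "integral\<^sup>L \<pi> v = 1"
    using v_nonneg v_mass by (auto intro: integrableI_nonneg simp: integral_eq_nn_integral)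
  have g_eq: "(\<integral>\<^sup>+ \<theta>. ennreal (enn2real (g \<theta>)) \<partial>\<pi>) = (\<integral>\<^sup>+ \<theta>. g \<theta> \<partial>\<pi>)"
    using g_finite by (intro nn_integral_cong_AE) (auto simp: less_top)
  have g_int: "integrable \<pi> (\<lambda>\<theta>. enn2real (g \<theta>))"
      "(\<integral>\<theta>. enn2real (g \<theta>) \<partial>\<pi>) = enn2real (\<integral>\<^sup>+ \<theta>. g \<theta> \<partial>\<pi>)"
    using False g_eq by (auto intro!: integrableI_nonneg simp: integral_eq_nn_integral less_top g_def)
  show ?thesis
  proof (rule le_add_eln_if_le_tangents)
    show "(\<integral>\<^sup>+ \<theta>. ennreal (exp (- s \<theta>)) * u \<theta> \<partial>\<pi>) < \<top>"
      using False by (simp add: less_top)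
    fix c :: real
    define h where "h \<theta> = c * v \<theta> + exp (- c) * enn2real (g \<theta>) - v \<theta>" for \<theta>
    have h_int: "integrable \<pi> h"
      "integral\<^sup>L \<pi> h = c + exp (- c) * enn2real (\<integral>\<^sup>+ \<theta>. g \<theta> \<partial>\<pi>) - 1"
      unfolding h_def using v_int g_int by simp_all
    have "AE \<theta> in \<pi>. ereal (v \<theta>) * eln (u \<theta>)
        \<le> ereal (v \<theta> * s \<theta>) + ereal (v \<theta> * ln (v \<theta>)) + ereal (h \<theta>)"
      using g_finite v_nonneg
    proof eventually_elim
      case (elim \<theta>)
      show ?case
      proof (cases "v \<theta> = 0")
        case True
        then show ?thesis by (simp add: h_def flip: zero_ereal_def)
      next
        case False
        with elim have v_pos: "0 < v \<theta>" by simp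
        have u_fin: "u \<theta> < \<top>" using elim by (auto simp: g_def ennreal_mult_eq_top_iff less_top)
        have "eln (u \<theta>) \<le> ereal ((c + s \<theta> + ln (v \<theta>)) + exp (- (c + s \<theta> + ln (v \<theta>))) * enn2real (u \<theta>) - 1)"
          by (rule eln_le_tangent[OF u_fin])
        then have "ereal (v \<theta>) * eln (u \<theta>) \<le> ereal (v \<theta>) * ereal ((c + s \<theta> + ln (v \<theta>)) + exp (- (c + s \<theta> + ln (v \<theta>))) * enn2real (u \<theta>) - 1)"
          using v_pos by (intro ereal_mult_left_mono) auto
        also have "\<dots> = ereal (v \<theta> * s \<theta> + v \<theta> * ln (v \<theta>) + h \<theta>)"
          using v_pos by (simp add: h_def g_def enn2real_mult exp_add exp_diff exp_minus field_simps)
        finally show ?thesis by simp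
      qed
    qed
    then have "ext_integral \<pi> (\<lambda>\<theta>. ereal (v \<theta>) * eln (u \<theta>))
      \<le> ext_integral \<pi> (\<lambda>\<theta>. ereal (v \<theta> * s \<theta>)) + ext_integral \<pi> (\<lambda>\<theta>. ereal (v \<theta> * ln (v \<theta>)))
        + ereal (integral\<^sup>L \<pi> h)"
      by (intro ext_integral_mono_add h_int qi) measurable
    then show "ext_integral \<pi> (\<lambda>\<theta>. ereal (v \<theta>) * eln (u \<theta>))
      \<le> ext_integral \<pi> (\<lambda>\<theta>. ereal (v \<theta> * s \<theta>)) + D_KL \<pi> v
        + ereal (c + exp (- c) * enn2real (\<integral>\<^sup>+ \<theta>. ennreal (exp (- s \<theta>)) * u \<theta> \<partial>\<pi>) - 1)"
      by (simp add: D_KL_def h_int g_def)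
  qed
qed

section \<open>From a mean to its logarithm: deviation and expectation\<close>

text \<open>This is Markov's inequality for \<open>G\<close> at the level \<open>exp t\<close> times its mean. A mean of \<open>0\<close> or \<open>\<infinity>\<close>
  gives the bound almost surely.\<close>

lemma eln_le_shifted_mean_prob:
  assumes "prob_space S" and [measurable]: "G \<in> borel_measurable S"
  shows "measure S {X \<in> space S. eln (G X) \<le> ereal t + eln (\<integral>\<^sup>+ X. G X \<partial>S)} \<ge> 1 - exp (- t)"
proof -
  interpret prob_space S by fact
  define Z where "Z = (\<integral>\<^sup>+ X. G X \<partial>S)"
  consider "Z = 0" | "Z = \<top>" | z where "Z = ennreal z" "0 < z"
    by (cases Z) (auto simp: less_le)
  then show ?thesis
  proof cases
    case 1
    then have "AE X in S. G X = 0" by (simp add: Z_def nn_integral_0_iff_AE)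
    then have "prob {X \<in> space S. eln (G X) \<le> ereal t + eln Z} = 1"
      using 1 by (intro prob_Collect_eq_1[THEN iffD2]) (auto simp: eln_def)
    then show ?thesis by (simp add: Z_def)
  next
    case 2
    then show ?thesis by (simp add: Z_def eln_def prob_space)
  next
    case 3
    let ?bad = "{X \<in> space S. 1 \<le> ennreal (exp (- t) / z) * G X}"
    have "emeasure S ?bad \<le> ennreal (exp (- t) / z) * (\<integral>\<^sup>+ X. G X * indicator (space S) X \<partial>S)"
      using nn_integral_Markov_inequality[of G "space S" S "ennreal (exp (- t) / z)"] by simp
    also have "\<dots> = ennreal (exp (- t))"
      using 3 by (simp add: Z_def cong: nn_integral_cong flip: ennreal_mult)
    finally have bad: "prob ?bad \<le> exp (- t)"
      by (simp add: emeasure_eq_measure)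
    have "eln y \<le> ereal (t + ln z)" if "\<not> 1 \<le> ennreal (exp (- t) / z) * y" for y
    proof (cases "y = 0")
      case False
      have "y \<noteq> \<top>" using that 3 by (auto simp: ennreal_mult_top)
      with False obtain r where r: "y = ennreal r" "0 < r" by (cases y) (auto simp: less_le)
      with that 3 have "exp (- t) / z * r < 1"
        by (simp add: not_le ennreal_less_one_iff flip: ennreal_mult)
      then have "r < exp (t + ln z)" using 3 by (simp add: exp_minus exp_add field_simps)
      then have "ln r < t + ln z" using r by (metis ln_exp ln_less_cancel_iff exp_gt_zero)
      then show ?thesis using r by (simp add: eln_def)
    qed (simp add: eln_def)
    then have "space S - ?bad \<subseteq> {X \<in> space S. eln (G X) \<le> ereal t + eln Z}"
      using 3 by (auto simp: eln_def[of "ennreal z"])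
    then have "prob (space S - ?bad) \<le> prob {X \<in> space S. eln (G X) \<le> ereal t + eln Z}"
      by (intro finite_measure_mono) auto
    then show ?thesis using bad by (simp add: prob_compl Z_def)
  qed
qed

text \<open>This is Jensen's inequality \<open>E ln G \<le> ln E G\<close> with an additive term. Bounding \<open>ln G\<close> by its
  integrable tangents before integrating avoids any assumption on the integral of \<open>ln G\<close>, which
  need not be defined.\<close>

lemma ext_integral_le_add_eln_mean:
  assumes "prob_space S" and [measurable]: "G \<in> borel_measurable S" "R \<in> borel_measurable S" "Y \<in> borel_measurable S"
    and qi: "quasi_integrable S R"
    and le: "AE X in S. R X \<le> Y X + eln (G X)"
  shows "ext_integral S R \<le> ext_integral S Y + eln (\<integral>\<^sup>+ X. G X \<partial>S)"
proof (cases "(\<integral>\<^sup>+ X. G X \<partial>S) = \<top>")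
  case True
  then show ?thesis by (simp add: eln_def)
next
  case False
  interpret prob_space S by fact
  have G_finite: "AE X in S. G X \<noteq> \<infinity>"
    using False by (intro nn_integral_PInf_AE) auto
  have G_eq: "(\<integral>\<^sup>+ X. ennreal (enn2real (G X)) \<partial>S) = (\<integral>\<^sup>+ X. G X \<partial>S)"
    using G_finite by (intro nn_integral_cong_AE) (auto simp: less_top)
  have G_int: "integrable S (\<lambda>X. enn2real (G X))"
      "(\<integral>X. enn2real (G X) \<partial>S) = enn2real (\<integral>\<^sup>+ X. G X \<partial>S)"
    using False G_eq by (auto intro!: integrableI_nonneg simp: integral_eq_nn_integral less_top)
  show ?thesis
  proof (rule le_add_eln_if_le_tangents)
    fix c :: real
    define h :: "_ \<Rightarrow> real" where "h X = c + exp (- c) * enn2real (G X) - 1" for X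
    have h: "integrable S h" "integral\<^sup>L S h = c + exp (- c) * enn2real (\<integral>\<^sup>+ X. G X \<partial>S) - 1"
      unfolding h_def using G_int by (simp_all add: prob_space)
    have "AE X in S. R X \<le> Y X + 0 + ereal (h X)"
      using le G_finite
    proof eventually_elim
      case (elim X)
      have "R X \<le> Y X + eln (G X)" by fact
      also have "\<dots> \<le> Y X + ereal (h X)"
        unfolding h_def using elim by (intro add_left_mono eln_le_tangent) (simp add: less_top)
      finally show ?case by simp
    qed
    from ext_integral_mono_add[OF _ _ _ h(1) qi this]
    show "ext_integral S R \<le> ext_integral S Y + ereal (c + exp (- c) * enn2real (\<integral>\<^sup>+ X. G X \<partial>S) - 1)"
      by (simp add: h ext_integral_def[of S "\<lambda>_. 0"])
  qed (use False in \<open>simp add: less_top\<close>)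
qed

section \<open>The sample law and exponential moments\<close>

lemma prob_space_density_if_is_density:
  assumes "is_density \<mu> q"
  shows "prob_space (density \<mu> (\<lambda>x. ennreal (q x)))"
proof
  have [measurable]: "q \<in> borel_measurable \<mu>" using assms by (simp add: is_density_def)
  show "emeasure (density \<mu> (\<lambda>x. ennreal (q x))) (space (density \<mu> (\<lambda>x. ennreal (q x)))) = 1"
    using assms by (simp add: emeasure_density is_density_def cong: nn_integral_cong)
qed

lemma prob_space_sample_law:
  assumes "is_density \<mu> q"
  shows "prob_space (sample_law \<mu> q n)"
  unfolding sample_law_def by (intro prob_space_PiM prob_space_density_if_is_density assms)

lemma exp_moment_measurable:
  assumes "is_density \<mu> q" and l: "(\<lambda>(\<theta>, x). l \<theta> x) \<in> borel_measurable (\<pi> \<Otimes>\<^sub>M \<mu>)"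
  shows "(\<lambda>\<theta>. exp_moment \<mu> q l b \<theta>) \<in> borel_measurable \<pi>"
proof -
  interpret P: prob_space "density \<mu> (\<lambda>x. ennreal (q x))"
    by (rule prob_space_density_if_is_density) fact
  have "sets (\<pi> \<Otimes>\<^sub>M density \<mu> (\<lambda>x. ennreal (q x))) = sets (\<pi> \<Otimes>\<^sub>M \<mu>)"
    by (intro sets_pair_measure_cong) auto
  then have [measurable]: "(\<lambda>(\<theta>, x). l \<theta> x) \<in> borel_measurable (\<pi> \<Otimes>\<^sub>M density \<mu> (\<lambda>x. ennreal (q x)))"
    using l by (simp cong: measurable_cong_sets)
  show ?thesis unfolding exp_moment_def by measurable
qed

lemma empirical_loss_measurable:
  fixes l :: "'t \<Rightarrow> 'x \<Rightarrow> real"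
  assumes l: "(\<lambda>(\<theta>, x). l \<theta> x) \<in> borel_measurable (\<pi> \<Otimes>\<^sub>M \<mu>)"
  shows "(\<lambda>(X, \<theta>). \<Sum>i=1..n. l \<theta> (X i)) \<in> borel_measurable (sample_law \<mu> q n \<Otimes>\<^sub>M \<pi>)"
proof -
  have summand: "(\<lambda>(X, \<theta>). l \<theta> (X i)) \<in> borel_measurable (sample_law \<mu> q n \<Otimes>\<^sub>M \<pi>)" if "i \<in> {1..n}" for i
  proof -
    have "(\<lambda>X. X i) \<in> sample_law \<mu> q n \<rightarrow>\<^sub>M density \<mu> (\<lambda>x. ennreal (q x))"
      unfolding sample_law_def using that by (rule measurable_component_singleton)
    then have [measurable]: "(\<lambda>X. X i) \<in> sample_law \<mu> q n \<rightarrow>\<^sub>M \<mu>"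
      by simp
    have "(\<lambda>p. (snd p, fst p i)) \<in> sample_law \<mu> q n \<Otimes>\<^sub>M \<pi> \<rightarrow>\<^sub>M \<pi> \<Otimes>\<^sub>M \<mu>"
      by measurable
    from measurable_compose[OF this l] show ?thesis by (simp add: case_prod_beta)
  qed
  show ?thesis
    unfolding case_prod_beta
    by (rule borel_measurable_sum) (rule summand[unfolded case_prod_beta])
qed

lemma nn_integral_exp_neg_empirical_loss:
  assumes "is_density \<mu> q" and l: "(\<lambda>(\<theta>, x). l \<theta> x) \<in> borel_measurable (\<pi> \<Otimes>\<^sub>M \<mu>)"
    and \<theta>: "\<theta> \<in> space \<pi>"
  shows "(\<integral>\<^sup>+ X. ennreal (exp (- (\<Sum>i=1..n. l \<theta> (X i)))) \<partial>sample_law \<mu> q n) = exp_moment \<mu> q l 1 \<theta> ^ n"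
proof -
  interpret P: prob_space "density \<mu> (\<lambda>x. ennreal (q x))"
    by (rule prob_space_density_if_is_density) fact
  interpret product_sigma_finite "\<lambda>_. density \<mu> (\<lambda>x. ennreal (q x))"
    by unfold_locales
  have [measurable]: "l \<theta> \<in> borel_measurable \<mu>"
    using measurable_Pair2[OF l \<theta>] by simp
  have "(\<integral>\<^sup>+ X. ennreal (exp (- (\<Sum>i=1..n. l \<theta> (X i)))) \<partial>sample_law \<mu> q n)
      = (\<integral>\<^sup>+ X. (\<Prod>i=1..n. ennreal (exp (- l \<theta> (X i)))) \<partial>sample_law \<mu> q n)"
    by (simp add: exp_sum prod_ennreal flip: sum_negf)
  also have "\<dots> = exp_moment \<mu> q l 1 \<theta> ^ n"
    unfolding sample_law_def by (subst product_nn_integral_prod) (simp_all add: exp_moment_def)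
  finally show ?thesis .
qed

text \<open>The prior does not depend on the sample, so the two integrals can be exchanged; for fixed
  \<open>\<theta>\<close> the exponential of the sum then factorises over the independent samples. This is the
  step that identifies the constant \<open>c\<^sub>n\<close>.\<close>

lemma expected_gibbs_mass:
  assumes q: "is_density \<mu> q" and "prob_space \<pi>"
    and l: "(\<lambda>(\<theta>, x). l \<theta> x) \<in> borel_measurable (\<pi> \<Otimes>\<^sub>M \<mu>)"
    and u [measurable]: "u \<in> borel_measurable \<pi>"
  shows "(\<integral>\<^sup>+ X. (\<integral>\<^sup>+ \<theta>. ennreal (exp (- (\<Sum>i=1..n. l \<theta> (X i)))) * u \<theta> \<partial>\<pi>) \<partial>sample_law \<mu> q n)
    = (\<integral>\<^sup>+ \<theta>. exp_moment \<mu> q l 1 \<theta> ^ n * u \<theta> \<partial>\<pi>)"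
proof -
  interpret S: prob_space "sample_law \<mu> q n" by (rule prob_space_sample_law[OF q])
  interpret \<pi>: prob_space \<pi> by fact
  interpret pair_sigma_finite "sample_law \<mu> q n" \<pi> by unfold_locales
  note [measurable] = empirical_loss_measurable[OF l, of n q]
  have "(\<integral>\<^sup>+ X. (\<integral>\<^sup>+ \<theta>. ennreal (exp (- (\<Sum>i=1..n. l \<theta> (X i)))) * u \<theta> \<partial>\<pi>) \<partial>sample_law \<mu> q n)
    = (\<integral>\<^sup>+ \<theta>. (\<integral>\<^sup>+ X. ennreal (exp (- (\<Sum>i=1..n. l \<theta> (X i)))) * u \<theta> \<partial>sample_law \<mu> q n) \<partial>\<pi>)"
    by (rule Fubini'[symmetric]) measurable
  also have "\<dots> = (\<integral>\<^sup>+ \<theta>. exp_moment \<mu> q l 1 \<theta> ^ n * u \<theta> \<partial>\<pi>)"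
  proof (rule nn_integral_cong)
    fix \<theta> assume \<theta>: "\<theta> \<in> space \<pi>"
    have [measurable]: "(\<lambda>X. \<Sum>i=1..n. l \<theta> (X i)) \<in> borel_measurable (sample_law \<mu> q n)"
      using measurable_Pair1[OF empirical_loss_measurable[OF l, of n q] \<theta>]
      by (simp del: One_nat_def)
    show "(\<integral>\<^sup>+ X. ennreal (exp (- (\<Sum>i=1..n. l \<theta> (X i)))) * u \<theta> \<partial>sample_law \<mu> q n)
        = exp_moment \<mu> q l 1 \<theta> ^ n * u \<theta>"
      by (subst nn_integral_multc) (simp_all add: nn_integral_exp_neg_empirical_loss[OF q l \<theta>] del: One_nat_def)
  qed
  finally show ?thesis .
qed

section \<open>The posterior inequalities\<close>

lemma le_scaled_if_mult_le:
  assumes "n \<ge> 1" "ereal (real n) * x \<le> y + (ereal t + z)"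
  shows "x \<le> (y + ereal t) / ereal (real n) + ereal (1 / real n) * z"
  using assms by (cases x; cases y; cases z) (auto simp: field_simps)

theorem theorem2p1:
  fixes \<mu> :: "'x measure" and q :: "'x \<Rightarrow> real"
    and \<pi> :: "'t measure" and l :: "'t \<Rightarrow> 'x \<Rightarrow> real"
    and w :: "(nat \<Rightarrow> 'x) \<Rightarrow> 't \<Rightarrow> real"
    and n :: nat and \<alpha> \<beta> :: real
  assumes q: "is_density \<mu> q"
    and prior: "prob_space \<pi>"
    and n: "n \<ge> 1"
    and l_meas: "(\<lambda>(\<theta>, x). l \<theta> x) \<in> borel_measurable (\<pi> \<Otimes>\<^sub>M \<mu>)"
    and w: "is_posterior \<mu> q n \<pi> w"
    \<comment> \<open>the expressions in the first inequality are well defined\<close>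
    and wd_quotient: "AE \<theta> in \<pi>. \<not> (exp_moment \<mu> q l 1 \<theta> = \<top> \<and> epowr (exp_moment \<mu> q l \<beta> \<theta>) \<alpha> = \<top>)"
    and wd_log: "AE X in sample_law \<mu> q n. quasi_integrable \<pi> (log_integrand \<mu> q l \<beta> (w X))"
    and wd_emp: "AE X in sample_law \<mu> q n. quasi_integrable \<pi> (emp_integrand l n X (w X))"
    and wd_sum: "AE X in sample_law \<mu> q n.
       add_defined (ext_integral \<pi> (emp_integrand l n X (w X))) (D_KL \<pi> (w X)) \<and>
       add_defined (ext_integral \<pi> (emp_integrand l n X (w X)) + D_KL \<pi> (w X)) (c_n \<mu> q \<pi> l n \<alpha> \<beta>)"
  shows
    "(\<forall>t::real.
       measure (sample_law \<mu> q n)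
         {X \<in> space (sample_law \<mu> q n).
            - ereal \<alpha> * ext_integral \<pi> (log_integrand \<mu> q l \<beta> (w X))
            \<le> (ext_integral \<pi> (emp_integrand l n X (w X)) + D_KL \<pi> (w X) + ereal t) / ereal (real n)
               + c_n \<mu> q \<pi> l n \<alpha> \<beta>}
       \<ge> 1 - exp (- t))
     \<and>
     \<comment> \<open>the outer expectations and the last sum are well defined\<close>
     (quasi_integrable (sample_law \<mu> q n)
        (\<lambda>X. ext_integral \<pi> (log_integrand \<mu> q l \<beta> (w X))) \<and>
      quasi_integrable (sample_law \<mu> q n)
        (\<lambda>X. (ext_integral \<pi> (emp_integrand l n X (w X)) + D_KL \<pi> (w X)) / ereal (real n)) \<and>
      add_defined
        (ext_integral (sample_law \<mu> q n)
           (\<lambda>X. (ext_integral \<pi> (emp_integrand l n X (w X)) + D_KL \<pi> (w X)) / ereal (real n)))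
        (c_n \<mu> q \<pi> l n \<alpha> \<beta>)
      \<longrightarrow>
      - ereal \<alpha> * ext_integral (sample_law \<mu> q n)
           (\<lambda>X. ext_integral \<pi> (log_integrand \<mu> q l \<beta> (w X)))
      \<le> ext_integral (sample_law \<mu> q n)
           (\<lambda>X. (ext_integral \<pi> (emp_integrand l n X (w X)) + D_KL \<pi> (w X)) / ereal (real n))
         + c_n \<mu> q \<pi> l n \<alpha> \<beta>)"

proof -
  define S where "S = sample_law \<mu> q n"
  define u where "u \<theta> = inverse (epowr (exp_moment \<mu> q l \<beta> \<theta>) \<alpha>) ^ n" for \<theta>
  define L where "L = (\<lambda>X. ext_integral \<pi> (log_integrand \<mu> q l \<beta> (w X)))"
  define E K where "E X = ext_integral \<pi> (emp_integrand l n X (w X))" and "K X = D_KL \<pi> (w X)" for X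
  define G where "G X = (\<integral>\<^sup>+ \<theta>. ennreal (exp (- (\<Sum>i=1..n. l \<theta> (X i)))) * u \<theta> \<partial>\<pi>)" for X
  define Z where "Z = (\<integral>\<^sup>+ X. G X \<partial>S)"
  interpret \<pi>: prob_space \<pi> by (fact prior)
  interpret S: prob_space S unfolding S_def by (rule prob_space_sample_law[OF q])

  have [measurable]: "(\<lambda>\<theta>. exp_moment \<mu> q l b \<theta>) \<in> borel_measurable \<pi>" for b
    by (rule exp_moment_measurable[OF q l_meas])
  have u_meas [measurable]: "u \<in> borel_measurable \<pi>"
    unfolding u_def by measurable
  have w_meas [measurable]: "(\<lambda>(X, \<theta>). w X \<theta>) \<in> borel_measurable (S \<Otimes>\<^sub>M \<pi>)"
    and w_density: "X \<in> space S \<Longrightarrow> is_density \<pi> (w X)" for X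
    using w by (auto simp: is_posterior_def S_def)
  have loss_meas [measurable]: "(\<lambda>(X, \<theta>). \<Sum>i=1..n. l \<theta> (X i)) \<in> borel_measurable (S \<Otimes>\<^sub>M \<pi>)"
    unfolding S_def by (rule empirical_loss_measurable[OF l_meas])
  have L_meas [measurable]: "L \<in> borel_measurable S"
    unfolding L_def log_integrand_def
    by (intro ext_integral_measurable \<pi>.sigma_finite_measure_axioms) measurable
  have E_meas [measurable]: "E \<in> borel_measurable S"
    unfolding E_def emp_integrand_def
    by (intro ext_integral_measurable \<pi>.sigma_finite_measure_axioms) measurable
  have K_meas [measurable]: "K \<in> borel_measurable S"
    unfolding K_def D_KL_def
    by (intro ext_integral_measurable \<pi>.sigma_finite_measure_axioms) measurable
  have G_meas [measurable]: "G \<in> borel_measurable S"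
    unfolding G_def by measurable

  have c_n_eq: "c_n \<mu> q \<pi> l n \<alpha> \<beta> = ereal (1 / real n) * eln Z"
    unfolding c_n_def Z_def G_def S_def
    by (subst expected_gibbs_mass[OF q prior l_meas u_meas])
       (simp add: u_def divide_ennreal_def power_mult_distrib)

  \<comment> \<open>Valid also where the moment is infinite, since \<open>epowr\<close> and \<open>inverse\<close> follow the limits.\<close>
  have log_u: "eln (u \<theta>) = ereal (- \<alpha> * real n) * eln (exp_moment \<mu> q l \<beta> \<theta>)" for \<theta>
    unfolding u_def eln_power eln_inverse eln_epowr
    by (cases "eln (exp_moment \<mu> q l \<beta> \<theta>)") (use n in \<open>auto simp: sgn_if zero_less_mult_iff mult_less_0_iff\<close>)

  have dv: "AE X in S. ereal (- \<alpha> * real n) * L X \<le> E X + K X + eln (G X)"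
    using wd_log[folded S_def] AE_space
  proof eventually_elim
    case (elim X)
    have [measurable]: "w X \<in> borel_measurable \<pi>" "(\<lambda>\<theta>. \<Sum>i=1..n. l \<theta> (X i)) \<in> borel_measurable \<pi>"
      using measurable_Pair2[OF w_meas elim(2)] measurable_Pair2[OF loss_meas elim(2)]
      by (simp_all del: One_nat_def)
    have [measurable]: "log_integrand \<mu> q l \<beta> (w X) \<in> borel_measurable \<pi>"
      unfolding log_integrand_def by measurable
    have log_eq: "ereal (w X \<theta>) * eln (u \<theta>) = ereal (- \<alpha> * real n) * log_integrand \<mu> q l \<beta> (w X) \<theta>" for \<theta>
      by (simp only: log_u log_integrand_def mult.left_commute)
    have "ext_integral \<pi> (\<lambda>\<theta>. ereal (w X \<theta>) * eln (u \<theta>)) \<le> E X + K X + eln (G X)"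
      unfolding E_def K_def G_def emp_integrand_def
      using quasi_integrable_cmult[OF _ elim(1)]
      by (intro donsker_varadhan prior w_density elim) (simp_all add: log_eq del: One_nat_def)
    also have "ext_integral \<pi> (\<lambda>\<theta>. ereal (w X \<theta>) * eln (u \<theta>)) = ereal (- \<alpha> * real n) * L X"
      unfolding log_eq L_def by (rule ext_integral_cmult) (use elim in auto)
    finally show ?case .
  qed

  have scale: "ereal (- \<alpha> * real n) * x = ereal (real n) * (- ereal \<alpha> * x)" for x
  proof -
    have "ereal (- \<alpha> * real n) = ereal (real n) * - ereal \<alpha>" by simp
    then show ?thesis by (simp only: mult.assoc)
  qed

  have deviation: "1 - exp (- t) \<le> measure S {X \<in> space S.
      - ereal \<alpha> * L X \<le> (E X + K X + ereal t) / ereal (real n) + c_n \<mu> q \<pi> l n \<alpha> \<beta>}" for t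
  proof -
    have "1 - exp (- t) \<le> measure S {X \<in> space S. eln (G X) \<le> ereal t + eln Z}"
      unfolding Z_def by (intro eln_le_shifted_mean_prob S.prob_space_axioms G_meas)
    also have "\<dots> \<le> measure S {X \<in> space S.
      - ereal \<alpha> * L X \<le> (E X + K X + ereal t) / ereal (real n) + c_n \<mu> q \<pi> l n \<alpha> \<beta>}"
    proof (rule S.finite_measure_mono_AE)
      show "AE X in S. X \<in> {X \<in> space S. eln (G X) \<le> ereal t + eln Z} \<longrightarrow> X \<in> {X \<in> space S.
        - ereal \<alpha> * L X \<le> (E X + K X + ereal t) / ereal (real n) + c_n \<mu> q \<pi> l n \<alpha> \<beta>}"
        using dv
      proof eventually_elim
        case (elim X)
        show ?case
        proof safe
          assume "eln (G X) \<le> ereal t + eln Z"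
          then have "ereal (real n) * (- ereal \<alpha> * L X) \<le> E X + K X + (ereal t + eln Z)"
            using elim unfolding scale by (meson add_left_mono order_trans)
          from le_scaled_if_mult_le[OF n this]
          show "- ereal \<alpha> * L X \<le> (E X + K X + ereal t) / ereal (real n) + c_n \<mu> q \<pi> l n \<alpha> \<beta>"
            unfolding c_n_eq .
        qed
      qed
    qed measurable
    finally show ?thesis .
  qed

  have mean: "- ereal \<alpha> * ext_integral S L
      \<le> ext_integral S (\<lambda>X. (E X + K X) / ereal (real n)) + c_n \<mu> q \<pi> l n \<alpha> \<beta>"
    if qi: "quasi_integrable S L"
  proof -
    have "ereal (- \<alpha> * real n) * ext_integral S L = ext_integral S (\<lambda>X. ereal (- \<alpha> * real n) * L X)"
      by (rule ext_integral_cmult[symmetric]) (use qi in auto)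
    also have "\<dots> \<le> ext_integral S (\<lambda>X. E X + K X) + eln Z"
      unfolding Z_def using dv
      by (intro ext_integral_le_add_eln_mean S.prob_space_axioms quasi_integrable_cmult qi) auto
    finally have "ereal (real n) * (- ereal \<alpha> * ext_integral S L)
        \<le> ext_integral S (\<lambda>X. E X + K X) + (ereal 0 + eln Z)"
      unfolding scale by simp
    from le_scaled_if_mult_le[OF n this]
    have "- ereal \<alpha> * ext_integral S L \<le> ext_integral S (\<lambda>X. E X + K X) / ereal (real n) + c_n \<mu> q \<pi> l n \<alpha> \<beta>"
      unfolding c_n_eq by simp
    moreover have "ext_integral S (\<lambda>X. E X + K X) / ereal (real n) = ext_integral S (\<lambda>X. (E X + K X) / ereal (real n))"
    proof -
      have div: "x / ereal (real n) = ereal (1 / real n) * x" for x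
        using n by (cases x) auto
      show ?thesis unfolding div by (rule ext_integral_cmult_nonneg[symmetric]) auto
    qed
    ultimately show ?thesis by simp
  qed

  show ?thesis
  proof (intro conjI allI impI, goal_cases)
    case (1 t)
    show ?case using deviation[of t] unfolding S_def L_def E_def K_def .
  next
    case 2
    then show ?case using mean unfolding S_def L_def E_def K_def by (elim conjE)
  qed
qed

end
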